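(* For all positive integers $d$ and $k$, there are only finitely many (isomorphism classes of) geometric lattices $L$ of rank $d$ with $|\mu_L(\hat 0,\hat 1)|=k$.
   Context: A geometric lattice is a finite graded lattice with minimum $\hat0$ and maximum $\hat1$ whose rank function is semimodular ($r(x\vee y)+r(x\wedge y)\le r(x)+r(y)$) and which is atomistic (every element is a join of atoms). $\mu_L$ denotes the Möbius function of $L$. *)

theory Defs
  imports "HOL-Algebra.Lattice"
begin

definition covers :: "('a, 'b) gorder_scheme \<Rightarrow> 'a \<Rightarrow> 'a \<Rightarrow> bool" where
  "covers L y x \<longleftrightarrow> x \<in> carrier L \<and> y \<in> carrier L \<and> x \<sqsubset>\<^bsub>L\<^esub> y \<and>
     \<not> (\<exists>z \<in> carrier L. x \<sqsubset>\<^bsub>L\<^esub> z \<and> z \<sqsubset>\<^bsub>L\<^esub> y)"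

definition atoms :: "('a, 'b) gorder_scheme \<Rightarrow> 'a set" where
  "atoms L = {a. covers L a \<bottom>\<^bsub>L\<^esub>}"

definition is_rank_function :: "('a, 'b) gorder_scheme \<Rightarrow> ('a \<Rightarrow> nat) \<Rightarrow> bool" where
  "is_rank_function L r \<longleftrightarrow> r \<bottom>\<^bsub>L\<^esub> = 0 \<and> (\<forall>x y. covers L y x \<longrightarrow> r y = r x + 1)"

definition graded :: "('a, 'b) gorder_scheme \<Rightarrow> bool" where
  "graded L \<longleftrightarrow> (\<exists>r. is_rank_function L r)"

text \<open>On the carrier of a finite lattice the choice below is unique,
  see \<open>rank_function_unique\<close>.\<close>

definition rank_function :: "('a, 'b) gorder_scheme \<Rightarrow> 'a \<Rightarrow> nat" where
  "rank_function L = (SOME r. is_rank_function L r)"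

definition lattice_rank :: "('a, 'b) gorder_scheme \<Rightarrow> nat" where
  "lattice_rank L = rank_function L \<top>\<^bsub>L\<^esub>"

locale geometric_lattice = bounded_lattice L for L (structure) +
  assumes finite_carrier: "finite (carrier L)"
    and graded: "graded L"
    and semimodular: "\<lbrakk>x \<in> carrier L; y \<in> carrier L\<rbrakk> \<Longrightarrow>
      rank_function L (x \<squnion> y) + rank_function L (x \<sqinter> y)
        \<le> rank_function L x + rank_function L y"
    and atomistic: "x \<in> carrier L \<Longrightarrow> \<exists>A \<subseteq> atoms L. is_lub L x A"

text \<open>The guard only serves to make the recursion well-founded; outside finite posets
  the value is a dummy.\<close>

function moebius :: "('a, 'b) gorder_scheme \<Rightarrow> 'a \<Rightarrow> 'a \<Rightarrow> int" where
  "moebius L x y =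
    (if partial_order L \<and> finite (carrier L) \<and> x \<in> carrier L \<and> y \<in> carrier L \<and> x \<sqsubseteq>\<^bsub>L\<^esub> y
     then if x = y then 1
          else - (\<Sum>z \<in> {z \<in> carrier L. x \<sqsubseteq>\<^bsub>L\<^esub> z \<and> z \<sqsubset>\<^bsub>L\<^esub> y}. moebius L x z)
     else 0)"
  by pat_completeness auto
termination
proof (relation "measure (\<lambda>(L, x, y). card {z \<in> carrier L. z \<sqsubseteq>\<^bsub>L\<^esub> y})", simp)
  fix L :: "('a, 'b) gorder_scheme" and x y z
  assume A: "partial_order L \<and> finite (carrier L) \<and> x \<in> carrier L \<and> y \<in> carrier L \<and> x \<sqsubseteq>\<^bsub>L\<^esub> y"
    and z: "z \<in> {z \<in> carrier L. x \<sqsubseteq>\<^bsub>L\<^esub> z \<and> z \<sqsubset>\<^bsub>L\<^esub> y}"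
  interpret partial_order L using A by blast
  have zy: "z \<in> carrier L" "z \<sqsubseteq>\<^bsub>L\<^esub> y" "z \<noteq> y"
    using z by (auto simp: lless_def eq_is_equal)
  then have "{w \<in> carrier L. w \<sqsubseteq>\<^bsub>L\<^esub> z} \<subset> {w \<in> carrier L. w \<sqsubseteq>\<^bsub>L\<^esub> y}"
    using A le_trans le_antisym by blast
  then show "((L, x, z), L, x, y) \<in> measure (\<lambda>(L, x, y). card {z \<in> carrier L. z \<sqsubseteq>\<^bsub>L\<^esub> y})"
    using A by (simp add: psubset_card_mono)
qed

declare moebius.simps [simp del]

definition geometric_lattices :: "nat \<Rightarrow> nat \<Rightarrow> 'a gorder set" where
  "geometric_lattices d k = {L. geometric_lattice L \<and> lattice_rank L = d \<and>
     \<bar>moebius L \<bottom>\<^bsub>L\<^esub> \<top>\<^bsub>L\<^esub>\<bar> = int k}"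

definition order_isomorphic :: "('a, 'b) gorder_scheme \<Rightarrow> ('c, 'd) gorder_scheme \<Rightarrow> bool" where
  "order_isomorphic L M \<longleftrightarrow> (\<exists>f. bij_betw f (carrier L) (carrier M) \<and> order_emb L M f)"

text \<open>Isomorphism as a relation on a collection \<open>S\<close> of posets; the quotient
  \<open>S // isomorphism_on S\<close> is the set of isomorphism classes.\<close>

definition isomorphism_on :: "'a gorder set \<Rightarrow> 'a gorder rel" where
  "isomorphism_on S = {(L, M). L \<in> S \<and> M \<in> S \<and> order_isomorphic L M}"

lemma equiv_isomorphism_on:
  assumes "\<And>L. L \<in> S \<Longrightarrow> weak_partial_order L"
  shows "equiv S (isomorphism_on S)"
proof (rule equivI)
  show "isomorphism_on S \<subseteq> S \<times> S" by (auto simp: isomorphism_on_def)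
  show "refl_on S (isomorphism_on S)"
    using assms by (auto simp: refl_on_def isomorphism_on_def order_isomorphic_def order_emb_def
        intro!: exI[of _ id])
  show "sym (isomorphism_on S)"
  proof (rule symI)
    fix L M assume "(L, M) \<in> isomorphism_on S"
    then obtain f where LM: "L \<in> S" "M \<in> S" and f: "bij_betw f (carrier L) (carrier M)"
      and e: "order_emb L M f"
      by (auto simp: isomorphism_on_def order_isomorphic_def)
    let ?g = "the_inv_into (carrier L) f"
    have g: "bij_betw ?g (carrier M) (carrier L)"
      using f by (rule bij_betw_the_inv_into)
    have fg: "f (?g y) = y" "?g y \<in> carrier L" if "y \<in> carrier M" for y
      using f g that by (auto simp: f_the_inv_into_f_bij_betw bij_betwE)
    have "order_emb M L ?g"
      using e fg unfolding order_emb_def by metis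
    with g LM show "(M, L) \<in> isomorphism_on S"
      by (auto simp: isomorphism_on_def order_isomorphic_def)
  qed
  show "trans (isomorphism_on S)"
  proof (rule transI)
    fix L M N assume "(L, M) \<in> isomorphism_on S" "(M, N) \<in> isomorphism_on S"
    then obtain f g where S: "L \<in> S" "N \<in> S"
      and f: "bij_betw f (carrier L) (carrier M)" "order_emb L M f"
      and g: "bij_betw g (carrier M) (carrier N)" "order_emb M N g"
      by (auto simp: isomorphism_on_def order_isomorphic_def)
    have "bij_betw (g \<circ> f) (carrier L) (carrier N)"
      using f g bij_betw_trans by blast
    moreover have "order_emb L N (g \<circ> f)"
      using f g bij_betwE[OF f(1)] by (auto simp: order_emb_def)
    ultimately show "(L, N) \<in> isomorphism_on S"
      using S by (auto simp: isomorphism_on_def order_isomorphic_def)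
  qed
qed

lemma rank_function_unique:
  assumes "bounded_lattice L" and fin: "finite (carrier L)"
    and r: "is_rank_function L r" and s: "is_rank_function L s"
    and "x \<in> carrier L"
  shows "r x = s x"
proof -
  interpret bounded_lattice L by fact
  let ?D = "\<lambda>x. {w \<in> carrier L. w \<sqsubset>\<^bsub>L\<^esub> x}"
  have sub: "?D w \<subset> ?D x" if "w \<in> ?D x" "x \<in> carrier L" for w x
  proof -
    have "?D w \<subseteq> ?D x"
      using that by (auto simp: lless_def eq_is_equal dest: le_antisym intro: le_trans)
    moreover have "w \<notin> ?D w" by (simp add: lless_def eq_is_equal)
    ultimately show ?thesis using that by blast
  qed
  show ?thesis using \<open>x \<in> carrier L\<close>
  proof (induction "card (?D x)" arbitrary: x rule: less_induct)
    case less
    show ?case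
    proof (cases "x = \<bottom>\<^bsub>L\<^esub>")
      case True then show ?thesis using r s by (simp add: is_rank_function_def)
    next
      case False
      then have ne: "?D x \<noteq> {}"
        using less.prems bottom_closed bottom_lower by (auto simp: lless_def eq_is_equal)
      let ?M = "Max ((\<lambda>v. card (?D v)) ` ?D x)"
      have "?M \<in> (\<lambda>v. card (?D v)) ` ?D x"
        using ne fin by (intro Max_in) auto
      then obtain w where w: "w \<in> ?D x" and M: "?M = card (?D w)" by (rule imageE)
      have mx: "card (?D v) \<le> card (?D w)" if "v \<in> ?D x" for v
        unfolding M[symmetric] using that fin by (intro Max_ge) auto
      have "covers L x w" unfolding covers_def
      proof (intro conjI notI)
        assume "\<exists>z\<in>carrier L. w \<sqsubset>\<^bsub>L\<^esub> z \<and> z \<sqsubset>\<^bsub>L\<^esub> x"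
        then obtain z where z: "z \<in> carrier L" "w \<in> ?D z" "z \<in> ?D x" using w by auto
        then have "card (?D w) < card (?D z)"
          using sub[of w z] fin by (intro psubset_card_mono) auto
        then show False using mx[of z] z by simp
      qed (use w less.prems in auto)
      moreover have "r w = s w"
        using less.hyps[of w] sub[of w x] w less.prems fin
        by (simp add: psubset_card_mono)
      ultimately show ?thesis using r s by (simp add: is_rank_function_def)
    qed
  qed
qed

end

theory Submission
  imports Defs
begin

text \<open>
  Fix an atom \<open>a \<le> x\<close>. Weisner's theorem and semimodularity express \<open>\<mu>(0,x)\<close> as minus the sum of
  \<open>\<mu>(0,y)\<close> over the lower covers \<open>y\<close> of \<open>x\<close> with \<open>y \<squnion> a = x\<close>. Hence the sign of \<open>\<mu>(0,x)\<close> is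
  \<open>(-1)\<close> to the rank of \<open>x\<close>, and \<open>\<bar>\<mu>(0,x)\<bar>\<close> is the sum of the positive integers \<open>\<bar>\<mu>(0,y)\<bar>\<close>.
  If \<open>\<bar>\<mu>(0,x)\<bar> \<le> k\<close>, then there are at most \<open>k\<close> such \<open>y\<close> and each of them has \<open>\<bar>\<mu>(0,y)\<bar> \<le> k\<close>.
  Every atom below \<open>x\<close> other than \<open>a\<close> lies below one of these \<open>y\<close>, so by induction on the rank
  the number of atoms is bounded in terms of the rank and \<open>k\<close>. Elements are determined by the atoms
  below them, so the size of the lattice is bounded as well.
\<close>

section \<open>Finite posets up to isomorphism\<close>

lemma finite_quotient_if_finite_invariant:
  assumes "equiv S R" and "finite (c ` S)"
    and complete: "\<And>x y. x \<in> S \<Longrightarrow> y \<in> S \<Longrightarrow> c x = c y \<Longrightarrow> (x, y) \<in> R"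
  shows "finite (S // R)"
proof -
  let ?h = "\<lambda>t. R `` {SOME y. y \<in> S \<and> c y = t}"
  have "R `` {x} = ?h (c x)" if "x \<in> S" for x
  proof -
    have "(SOME y. y \<in> S \<and> c y = c x) \<in> S \<and> c (SOME y. y \<in> S \<and> c y = c x) = c x"
      by (rule someI[of _ x]) (use that in simp)
    then show ?thesis
      using complete[OF that] equiv_class_eq[OF assms(1)] by metis
  qed
  then have "S // R \<subseteq> ?h ` c ` S"
    by (auto simp: quotient_def)
  then show ?thesis
    using assms(2) finite_subset by blast
qed

text \<open>Numbering each carrier turns its order into a relation on an initial segment of the
  naturals. Size and relation take finitely many values. The code depends on the numbering chosen,
  but equal codes do force isomorphism.\<close>

lemma finite_isomorphism_classes_if_bounded_card:
  fixes S :: "'a gorder set"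
  assumes po: "\<And>L. L \<in> S \<Longrightarrow> weak_partial_order L"
    and fin: "\<And>L. L \<in> S \<Longrightarrow> finite (carrier L)"
    and bound: "\<And>L. L \<in> S \<Longrightarrow> card (carrier L) \<le> N"
  shows "finite (S // isomorphism_on S)"
proof -
  have "\<exists>g. \<forall>L \<in> S. bij_betw (g L) {..<card (carrier L)} (carrier L)"
    using fin ex_bij_betw_nat_finite unfolding atLeast0LessThan by (intro bchoice) blast
  then obtain g where g: "\<And>L. L \<in> S \<Longrightarrow> bij_betw (g L) {..<card (carrier L)} (carrier L)"
    by blast
  define c where "c L = (card (carrier L),
    {(i, j). i < card (carrier L) \<and> j < card (carrier L) \<and> g L i \<sqsubseteq>\<^bsub>L\<^esub> g L j})" for L :: "'a gorder"
  show ?thesis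
  proof (rule finite_quotient_if_finite_invariant)
    show "equiv S (isomorphism_on S)"
      using po by (rule equiv_isomorphism_on)
    have "c ` S \<subseteq> {..N} \<times> Pow ({..<N} \<times> {..<N})"
      using bound by (fastforce simp: c_def)
    then show "finite (c ` S)"
      by (rule finite_subset) simp
    fix L M assume L: "L \<in> S" and M: "M \<in> S" and eq: "c L = c M"
    let ?n = "card (carrier L)"
    let ?gi = "the_inv_into {..<?n} (g L)"
    have n: "card (carrier M) = ?n" using eq by (simp add: c_def)
    have le: "g L i \<sqsubseteq>\<^bsub>L\<^esub> g L j \<longleftrightarrow> g M i \<sqsubseteq>\<^bsub>M\<^esub> g M j" if "i < ?n" "j < ?n" for i j
    proof -
      have "(i, j) \<in> snd (c L) \<longleftrightarrow> (i, j) \<in> snd (c M)" using eq by simp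
      then show ?thesis using that n by (simp add: c_def)
    qed
    have gi: "bij_betw ?gi (carrier L) {..<?n}"
      using g[OF L] by (rule bij_betw_the_inv_into)
    have inv: "g L (?gi x) = x" "?gi x < ?n" if "x \<in> carrier L" for x
      using f_the_inv_into_f_bij_betw[OF g[OF L]] that bij_betwE[OF gi] by auto
    \<comment> \<open>The isomorphism matches elements that carry the same number.\<close>
    have "bij_betw (g M \<circ> ?gi) (carrier L) (carrier M)"
      using bij_betw_trans[OF gi] g[OF M] n by simp
    moreover have "order_emb L M (g M \<circ> ?gi)"
      using po L M le inv by (simp add: order_emb_def flip: le)
    ultimately show "(L, M) \<in> isomorphism_on S"
      using L M by (auto simp: isomorphism_on_def order_isomorphic_def)
  qed
qed

section \<open>Rank and atoms\<close>

context geometric_lattice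
begin

lemma is_rank_function_rank_function: "is_rank_function L (rank_function L)"
  using graded unfolding graded_def rank_function_def by (rule someI_ex)

lemma rank_bottom [simp]: "rank_function L \<bottom> = 0"
  using is_rank_function_rank_function by (simp add: is_rank_function_def)

lemma rank_covers: "covers L y x \<Longrightarrow> rank_function L y = rank_function L x + 1"
  using is_rank_function_rank_function by (simp add: is_rank_function_def)

text \<open>The grading speaks of covers only. A longer interval is split at an interior point, by
  induction on the number of such points.\<close>

lemma rank_strict_mono:
  assumes "x \<in> carrier L" "y \<in> carrier L" "x \<sqsubset> y"
  shows "rank_function L x < rank_function L y"
  using assms
proof (induction "card {z \<in> carrier L. x \<sqsubset> z \<and> z \<sqsubset> y}" arbitrary: x y rule: less_induct)
  case less
  let ?I = "\<lambda>x y. {z \<in> carrier L. x \<sqsubset> z \<and> z \<sqsubset> y}"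
  show ?case
  proof (cases "covers L y x")
    case True
    then show ?thesis by (simp add: rank_covers)
  next
    case False
    then obtain z where z: "z \<in> carrier L" "x \<sqsubset> z" "z \<sqsubset> y"
      using less.prems by (auto simp: covers_def)
    \<comment> \<open>\<open>z\<close> is interior to the interval but to neither half, so both
      halves have fewer interior points.\<close>
    have irr: "\<not> z \<sqsubset> z" by (simp add: lless_eq)
    have "?I x z \<subset> ?I x y" "?I z y \<subset> ?I x y"
      using z less.prems irr lless_trans by blast+
    then have "card (?I x z) < card (?I x y)" "card (?I z y) < card (?I x y)"
      using finite_carrier by (simp_all add: psubset_card_mono)
    then show ?thesis
      using less.hyps[of x z] less.hyps[of z y] z less.prems by simp
  qed
qed

lemma rank_mono:
  assumes "x \<in> carrier L" "y \<in> carrier L" "x \<sqsubseteq> y"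
  shows "rank_function L x \<le> rank_function L y"
  using assms rank_strict_mono[of x y] by (cases "x = y") (auto simp: lless_eq)

lemma eq_if_le_if_rank_le:
  assumes "x \<in> carrier L" "y \<in> carrier L" "x \<sqsubseteq> y" "rank_function L y \<le> rank_function L x"
  shows "x = y"
  using assms rank_strict_mono[of x y] by (auto simp: lless_eq)

lemma atom_closed: "a \<in> atoms L \<Longrightarrow> a \<in> carrier L"
  by (simp add: atoms_def covers_def)

lemma atom_neq_bottom: "a \<in> atoms L \<Longrightarrow> a \<noteq> \<bottom>"
  by (auto simp: atoms_def covers_def lless_eq)

lemma finite_atoms: "finite (atoms L)"
  using finite_carrier atom_closed by (meson finite_subset subsetI)

lemma rank_atom: "a \<in> atoms L \<Longrightarrow> rank_function L a = 1"
  using rank_covers by (fastforce simp: atoms_def)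

lemma atom_le_atom_iff:
  assumes "a \<in> atoms L" "b \<in> atoms L"
  shows "a \<sqsubseteq> b \<longleftrightarrow> a = b"
  using assms eq_if_le_if_rank_le[of a b] by (auto simp: rank_atom atom_closed)

text \<open>By atomisticity \<open>x\<close> is the least upper bound of a set of atoms, and
  \<open>y\<close> is an upper bound of that set.\<close>

lemma le_if_atoms_le:
  assumes "x \<in> carrier L" "y \<in> carrier L"
    and "\<And>a. a \<in> atoms L \<Longrightarrow> a \<sqsubseteq> x \<Longrightarrow> a \<sqsubseteq> y"
  shows "x \<sqsubseteq> y"
proof -
  obtain A where A: "A \<subseteq> atoms L" "is_lub L x A"
    using atomistic[OF assms(1)] by blast
  have "a \<sqsubseteq> x" if "a \<in> A" for a
    using A that atom_closed by (auto simp: least_def Upper_def)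
  then have "y \<in> Upper L A"
    using A assms by (auto simp: Upper_def)
  then show ?thesis
    using A by (simp add: least_def)
qed

lemma ex_atom_le:
  assumes "x \<in> carrier L" "x \<noteq> \<bottom>"
  obtains a where "a \<in> atoms L" "a \<sqsubseteq> x"
  using le_if_atoms_le[of x \<bottom>] assms by (metis bottom_closed bottom_lower le_antisym)

text \<open>Semimodularity with an element of rank 1; the rank of the meet is dropped.\<close>

lemma rank_join_atom_le:
  assumes "x \<in> carrier L" "a \<in> atoms L"
  shows "rank_function L (x \<squnion> a) \<le> rank_function L x + 1"
  using semimodular[of x a] assms atom_closed rank_atom by fastforce

lemma card_carrier_le: "card (carrier L) \<le> 2 ^ card (atoms L)"
proof -
  have "inj_on (\<lambda>x. {a \<in> atoms L. a \<sqsubseteq> x}) (carrier L)"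
  proof (rule inj_onI)
    fix x y assume "x \<in> carrier L" "y \<in> carrier L"
      "{a \<in> atoms L. a \<sqsubseteq> x} = {a \<in> atoms L. a \<sqsubseteq> y}"
    then show "x = y"
      using le_if_atoms_le[of x y] le_if_atoms_le[of y x] by blast
  qed
  then have "card (carrier L) \<le> card (Pow (atoms L))"
    by (rule card_inj_on_le) (auto simp: finite_atoms)
  then show ?thesis
    by (simp add: card_Pow finite_atoms)
qed

section \<open>The Moebius function\<close>

abbreviation mu :: "'a \<Rightarrow> int" where
  "mu \<equiv> moebius L \<bottom>"

text \<open>For an atom \<open>a\<close> below \<open>x\<close> these are exactly the lower covers
  of \<open>x\<close> that are not above \<open>a\<close>: if \<open>y\<close> were above
  \<open>a\<close>, then \<open>y \<squnion> a\<close> would be \<open>y\<close>.\<close>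

definition atom_complements :: "'a \<Rightarrow> 'a \<Rightarrow> 'a set" where
  "atom_complements a x = {y \<in> carrier L. y \<noteq> x \<and> y \<squnion> a = x}"

lemma finite_atom_complements: "finite (atom_complements a x)"
  using finite_carrier by (simp add: atom_complements_def)

lemma mu_bottom [simp]: "mu \<bottom> = 1"
  using finite_carrier partial_order_axioms by (simp add: moebius.simps[of L \<bottom> \<bottom>])

lemma sum_mu_eq_0:
  assumes x: "x \<in> carrier L" "x \<noteq> \<bottom>"
  shows "(\<Sum>y | y \<in> carrier L \<and> y \<sqsubseteq> x. mu y) = 0"
proof -
  have "{y \<in> carrier L. y \<sqsubseteq> x} = insert x {y \<in> carrier L. \<bottom> \<sqsubseteq> y \<and> y \<sqsubset> x}"
    using x by (auto simp: lless_eq)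
  moreover have "mu x = - (\<Sum>y | y \<in> carrier L \<and> \<bottom> \<sqsubseteq> y \<and> y \<sqsubset> x. mu y)"
    using x finite_carrier partial_order_axioms by (subst moebius.simps) simp
  ultimately show ?thesis
    using finite_carrier by (simp add: lless_eq)
qed

text \<open>The fibres of joining with \<open>a\<close> over the interval from \<open>a\<close> to
  \<open>x\<close> partition the elements below \<open>x\<close>, so the fibre sums add up to 0. By
  induction those over \<open>z \<sqsubset> x\<close> vanish, which leaves the fibre over
  \<open>x\<close>.\<close>

theorem weisner:
  assumes "a \<in> carrier L" "a \<noteq> \<bottom>" "x \<in> carrier L" "a \<sqsubseteq> x"
  shows "(\<Sum>y | y \<in> carrier L \<and> y \<squnion> a = x. mu y) = 0"
  using assms(3,4)
proof (induction "rank_function L x" arbitrary: x rule: less_induct)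
  case less
  let ?S = "{y \<in> carrier L. y \<sqsubseteq> x}"
  let ?T = "{z \<in> carrier L. a \<sqsubseteq> z \<and> z \<sqsubseteq> x}"
  let ?f = "\<lambda>z. \<Sum>y | y \<in> carrier L \<and> y \<squnion> a = z. mu y"
  have x: "x \<noteq> \<bottom>"
    using less.prems assms by (metis bottom_closed bottom_lower le_antisym)
  \<comment> \<open>Every \<open>y\<close> in the fibre over \<open>z\<close> is below
    \<open>z\<close>, hence below \<open>x\<close>.\<close>
  have fib: "{y \<in> ?S. y \<squnion> a = z} = {y \<in> carrier L. y \<squnion> a = z}" if "z \<in> ?T" for z
    using that assms less.prems by (auto intro: le_trans[OF join_left])
  have "(\<Sum>z\<in>?T. ?f z) = (\<Sum>z\<in>?T. \<Sum>y | y \<in> ?S \<and> y \<squnion> a = z. mu y)"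
    by (rule sum.cong) (simp_all only: fib refl)
  also have "\<dots> = (\<Sum>y\<in>?S. mu y)"
    by (rule sum.group) (use finite_carrier assms less.prems in \<open>auto intro: join_right join_le\<close>)
  also have "\<dots> = 0"
    using less.prems x by (simp add: sum_mu_eq_0)
  finally have sum: "(\<Sum>z\<in>?T. ?f z) = 0" .
  have "?f z = 0" if "z \<in> ?T - {x}" for z
    using that less.hyps[of z] less.prems rank_strict_mono[of z x] by (auto simp: lless_eq)
  then have "(\<Sum>z\<in>?T. ?f z) = ?f x"
    using finite_carrier less.prems by (subst sum.remove[of _ x]) auto
  then show ?case
    using sum by simp
qed

text \<open>Since \<open>x \<squnion> a = x\<close>, the element \<open>x\<close> itself lies in
  Weisner's fibre, and its term is isolated.\<close>

lemma mu_eq_sum_atom_complements: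
  assumes "a \<in> atoms L" "x \<in> carrier L" "a \<sqsubseteq> x"
  shows "mu x = - (\<Sum>y\<in>atom_complements a x. mu y)"
proof -
  have "x \<squnion> a = x"
    using assms atom_closed by (metis join_le join_left join_closed le_antisym le_refl)
  then have "{y \<in> carrier L. y \<squnion> a = x} = insert x (atom_complements a x)"
    using assms by (auto simp: atom_complements_def)
  moreover have "x \<notin> atom_complements a x"
    by (simp add: atom_complements_def)
  ultimately show ?thesis
    using weisner[of a x] assms finite_atom_complements atom_closed atom_neq_bottom by simp
qed

section \<open>Existence and rank of atom complements\<close>

lemma rank_atom_complement:
  assumes a: "a \<in> atoms L" and x: "x \<in> carrier L" and y: "y \<in> atom_complements a x"
  shows "rank_function L x = rank_function L y + 1"
proof -
  have y': "y \<in> carrier L" "y \<noteq> x" "y \<squnion> a = x"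
    using y by (auto simp: atom_complements_def)
  have "y \<sqsubset> x"
    using y' join_left[of y a] a atom_closed by (auto simp: lless_eq)
  then show ?thesis
    using rank_strict_mono[of y x] rank_join_atom_le[of y a] y' x a by simp
qed

text \<open>Take \<open>y\<close> of maximal rank among the elements between \<open>w\<close> and
  \<open>x\<close> that are not above \<open>a\<close>. Maximality puts every atom below
  \<open>x\<close> under \<open>y \<squnion> a\<close>, so this join is \<open>x\<close>.\<close>

lemma ex_atom_complement_above:
  assumes a: "a \<in> atoms L" and x: "x \<in> carrier L" and "a \<sqsubseteq> x"
    and w: "w \<in> carrier L" "w \<sqsubseteq> x" "\<not> a \<sqsubseteq> w"
  obtains y where "y \<in> atom_complements a x" "w \<sqsubseteq> y"
proof -
  note ac = atom_closed[OF a]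
  let ?P = "\<lambda>y. y \<in> carrier L \<and> w \<sqsubseteq> y \<and> y \<sqsubseteq> x \<and> \<not> a \<sqsubseteq> y"
  have "\<exists>y. ?P y \<and> (\<forall>z. ?P z \<longrightarrow> rank_function L z \<le> rank_function L y)"
    by (rule ex_has_greatest_nat[of ?P w _ "Suc (rank_function L x)"])
      (use w x rank_mono in \<open>auto simp: less_Suc_eq_le\<close>)
  then obtain y where y: "?P y" and max: "\<And>z. ?P z \<Longrightarrow> rank_function L z \<le> rank_function L y"
    by blast
  have ya: "y \<squnion> a \<in> carrier L" "y \<squnion> a \<sqsubseteq> x"
    using y ac x assms by (auto intro: join_le)
  have "x \<sqsubseteq> y \<squnion> a"
  proof (rule le_if_atoms_le[OF x ya(1)])
    fix b assume b: "b \<in> atoms L" "b \<sqsubseteq> x"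
    note bc = atom_closed[OF b(1)]
    show "b \<sqsubseteq> y \<squnion> a"
    proof (cases "b \<sqsubseteq> y")
      case True
      then show ?thesis
        using y ac bc join_left[of y a] le_trans[of b y "y \<squnion> a"] by simp
    next
      case False
      have yb: "y \<squnion> b \<in> carrier L" "y \<sqsubseteq> y \<squnion> b" "b \<sqsubseteq> y \<squnion> b" "y \<squnion> b \<sqsubseteq> x"
        using y bc x b by (auto intro: join_le join_left join_right)
      have "y \<sqsubset> y \<squnion> b"
        using yb False by (auto simp: lless_eq)
      then have "rank_function L y < rank_function L (y \<squnion> b)"
        using rank_strict_mono y yb by simp
      \<comment> \<open>Its rank exceeds the maximum although it lies between \<open>w\<close> and
        \<open>x\<close>, so it must be above \<open>a\<close>.\<close>
      then have "\<not> ?P (y \<squnion> b)"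
        using max by fastforce
      then have "a \<sqsubseteq> y \<squnion> b"
        using yb y w le_trans[of w y "y \<squnion> b"] by blast
      then have le: "y \<squnion> a \<sqsubseteq> y \<squnion> b"
        using y ac yb by (auto intro: join_le)
      have "y \<sqsubset> y \<squnion> a"
        using y ac join_left[of y a] join_right[of y a] by (auto simp: lless_eq)
      then have "rank_function L y < rank_function L (y \<squnion> a)"
        using rank_strict_mono y ya by simp
      \<comment> \<open>Both joins cover \<open>y\<close>, so they coincide.\<close>
      then have "y \<squnion> a = y \<squnion> b"
        using eq_if_le_if_rank_le[OF ya(1) yb(1) le] rank_join_atom_le[of y b] y b by simp
      then show ?thesis
        using yb by simp
    qed
  qed
  then have "y \<in> atom_complements a x"
    using y ya x assms le_antisym by (auto simp: atom_complements_def)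
  then show thesis
    using that y by blast
qed

section \<open>Alternating sign of the Moebius function\<close>

text \<open>The rank drops by one from \<open>x\<close> to each complement, so the sign factor
  absorbs the minus sign.\<close>

lemma signed_mu_eq_sum_atom_complements:
  assumes "a \<in> atoms L" "x \<in> carrier L" "a \<sqsubseteq> x"
  shows "(-1) ^ rank_function L x * mu x
    = (\<Sum>y\<in>atom_complements a x. (-1) ^ rank_function L y * mu y)"
proof -
  have "(-1) ^ rank_function L x * mu x
      = (\<Sum>y\<in>atom_complements a x. - ((-1) ^ rank_function L x * mu y))"
    using mu_eq_sum_atom_complements[OF assms] by (simp add: sum_distrib_left sum_negf)
  also have "\<dots> = (\<Sum>y\<in>atom_complements a x. (-1) ^ rank_function L y * mu y)"
    using assms by (intro sum.cong) (auto simp: rank_atom_complement)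
  finally show ?thesis .
qed

text \<open>By induction on the rank every summand is positive. The sum is nonempty because some
  complement lies above \<bottom>.\<close>

lemma signed_mu_pos:
  assumes "x \<in> carrier L"
  shows "(-1) ^ rank_function L x * mu x > 0"
  using assms
proof (induction "rank_function L x" arbitrary: x rule: less_induct)
  case less
  show ?case
  proof (cases "x = \<bottom>")
    case True
    then show ?thesis by simp
  next
    case False
    then obtain a where a: "a \<in> atoms L" "a \<sqsubseteq> x"
      using ex_atom_le less.prems by blast
    have "\<not> a \<sqsubseteq> \<bottom>"
      using a atom_closed atom_neq_bottom bottom_closed bottom_lower le_antisym by metis
    then have ne: "atom_complements a x \<noteq> {}"
      using ex_atom_complement_above[of a x \<bottom>] a less.prems by auto
    have "(-1) ^ rank_function L x * mu x
        = (\<Sum>y\<in>atom_complements a x. (-1) ^ rank_function L y * mu y)"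
      using a less.prems by (intro signed_mu_eq_sum_atom_complements)
    also have "\<dots> > 0"
    proof (rule sum_pos[OF finite_atom_complements ne])
      fix y assume y: "y \<in> atom_complements a x"
      then show "(-1) ^ rank_function L y * mu y > 0"
        using less.hyps[of y] rank_atom_complement[of a x y] a less.prems
        by (simp add: atom_complements_def)
    qed
    finally show ?thesis .
  qed
qed

lemma abs_mu:
  assumes "x \<in> carrier L"
  shows "\<bar>mu x\<bar> = (-1) ^ rank_function L x * mu x"
proof -
  have "\<bar>mu x\<bar> = \<bar>(-1) ^ rank_function L x * mu x\<bar>"
    by (simp add: abs_mult)
  then show ?thesis
    using signed_mu_pos[OF assms] by simp
qed

lemma abs_mu_ge_1: "x \<in> carrier L \<Longrightarrow> 1 \<le> \<bar>mu x\<bar>"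
  using signed_mu_pos[of x] by (simp add: abs_mu)

lemma abs_mu_eq_sum_atom_complements:
  assumes "a \<in> atoms L" "x \<in> carrier L" "a \<sqsubseteq> x"
  shows "\<bar>mu x\<bar> = (\<Sum>y\<in>atom_complements a x. \<bar>mu y\<bar>)"
  unfolding abs_mu[OF assms(2)] signed_mu_eq_sum_atom_complements[OF assms]
  by (rule sum.cong) (simp_all add: abs_mu atom_complements_def)

end

section \<open>Bounding the number of atoms\<close>

text \<open>The recursion counts one chosen atom, plus the atoms below each of at most
  \<open>k\<close> complements of rank \<open>d\<close>.\<close>

fun atom_bound :: "nat \<Rightarrow> nat \<Rightarrow> nat" where
  "atom_bound k 0 = 0"
| "atom_bound k (Suc d) = 1 + k * atom_bound k d"

context geometric_lattice
begin

text \<open>Assuming an upper bound \<open>k\<close> instead of equality lets the induction pass to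
  the complements, whose Moebius values may be smaller.\<close>

lemma card_atoms_le_atom_bound:
  assumes "x \<in> carrier L" "rank_function L x = d" "\<bar>mu x\<bar> \<le> int k"
  shows "card {b \<in> atoms L. b \<sqsubseteq> x} \<le> atom_bound k d"
  using assms
proof (induction d arbitrary: x)
  case 0
  then have "x = \<bottom>"
    using eq_if_le_if_rank_le[of \<bottom> x] by simp
  then have "{b \<in> atoms L. b \<sqsubseteq> x} = {}"
    using atom_closed atom_neq_bottom bottom_closed bottom_lower le_antisym by blast
  then show ?case by (simp only: card.empty)
next
  case (Suc d)
  then have "x \<noteq> \<bottom>" by auto
  then obtain a where a: "a \<in> atoms L" "a \<sqsubseteq> x"
    using ex_atom_le Suc.prems by blast
  let ?C = "atom_complements a x"
  have sum: "(\<Sum>y\<in>?C. \<bar>mu y\<bar>) \<le> int k"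
    using abs_mu_eq_sum_atom_complements[of a x] a Suc.prems by simp
  \<comment> \<open>Every summand is at least 1, so there are at most as many complements as the
    sum.\<close>
  have "(\<Sum>y\<in>?C. 1) \<le> (\<Sum>y\<in>?C. \<bar>mu y\<bar>)"
    by (rule sum_mono) (simp add: abs_mu_ge_1 atom_complements_def)
  then have card: "card ?C \<le> k"
    using sum by simp
  have IH: "card {b \<in> atoms L. b \<sqsubseteq> y} \<le> atom_bound k d" if y: "y \<in> ?C" for y
  proof (rule Suc.IH)
    show "y \<in> carrier L" using y by (simp add: atom_complements_def)
    show "rank_function L y = d"
      using rank_atom_complement[of a x y] y a Suc.prems by simp
    have "\<bar>mu y\<bar> \<le> (\<Sum>y\<in>?C. \<bar>mu y\<bar>)"
      using y by (intro member_le_sum) (auto simp: finite_atom_complements)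
    then show "\<bar>mu y\<bar> \<le> int k" using sum by simp
  qed
  let ?U = "\<Union>y\<in>?C. {b \<in> atoms L. b \<sqsubseteq> y}"
  have "{b \<in> atoms L. b \<sqsubseteq> x} \<subseteq> insert a ?U"
  proof
    fix b assume b: "b \<in> {b \<in> atoms L. b \<sqsubseteq> x}"
    show "b \<in> insert a ?U"
    proof (cases "b = a")
      case False
      \<comment> \<open>Distinct atoms are incomparable, so \<open>b\<close> is not above
        \<open>a\<close> and can serve as \<open>w\<close>.\<close>
      then obtain y where "y \<in> ?C" "b \<sqsubseteq> y"
        using ex_atom_complement_above[of a x b] a b Suc.prems atom_closed atom_le_atom_iff[of a b]
        by auto
      then show ?thesis using b by blast
    qed simp
  qed
  then have "card {b \<in> atoms L. b \<sqsubseteq> x} \<le> card (insert a ?U)"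
    using finite_atoms finite_atom_complements by (intro card_mono) auto
  also have "\<dots> \<le> 1 + card ?U"
    using card_insert_le_m1[of "Suc (card ?U)" ?U a] by simp
  also have "card ?U \<le> (\<Sum>y\<in>?C. card {b \<in> atoms L. b \<sqsubseteq> y})"
    by (rule card_UN_le) (rule finite_atom_complements)
  also have "\<dots> \<le> card ?C * atom_bound k d"
    using sum_bounded_above[of ?C, OF IH] by simp
  also have "\<dots> \<le> k * atom_bound k d"
    using card by simp
  finally show ?case by simp
qed

lemma card_carrier_le_atom_bound:
  assumes "\<bar>moebius L \<bottom> \<top>\<bar> \<le> int k"
  shows "card (carrier L) \<le> 2 ^ atom_bound k (lattice_rank L)"
proof -
  have "{b \<in> atoms L. b \<sqsubseteq> \<top>} = atoms L"
    using atom_closed by auto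
  then have "card (atoms L) \<le> atom_bound k (lattice_rank L)"
    using card_atoms_le_atom_bound[of \<top>] assms by (simp add: lattice_rank_def)
  then show ?thesis
    using card_carrier_le by (meson one_le_numeral order_trans power_increasing)
qed

end

theorem theorem5p1:
  fixes d k :: nat
  assumes "d > 0" and "k > 0"
  shows "finite ((geometric_lattices d k :: 'a gorder set) //
                 isomorphism_on (geometric_lattices d k))"
proof (rule finite_isomorphism_classes_if_bounded_card)
  fix L :: "'a gorder" assume "L \<in> geometric_lattices d k"
  then have "geometric_lattice L" and d: "lattice_rank L = d"
    and k: "\<bar>moebius L \<bottom>\<^bsub>L\<^esub> \<top>\<^bsub>L\<^esub>\<bar> = int k"
    by (auto simp: geometric_lattices_def)
  then interpret geometric_lattice L by blast
  show "weak_partial_order L" by (rule weak_partial_order_axioms)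
  show "finite (carrier L)" by (rule finite_carrier)
  \<comment> \<open>The bound depends on \<open>d\<close> and \<open>k\<close> alone, so it is
    uniform over the collection.\<close>
  show "card (carrier L) \<le> 2 ^ atom_bound k d"
    using card_carrier_le_atom_bound[of k] d k by simp
qed

end
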